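(* Consider the sequence of $N$-systems with absolute priorities in the Halfin--Whitt asymptotic regime (defined in the context), and let $\hat X^{(n)}(\infty)$ be a random vector having the (unique) stationary distribution of the diffusion-scaled process $\hat X^{(n)}(\cdot)$. Then there exists a constant $C>0$ (not depending on $n$) such that for all sufficiently large $n$, $$\mathbb{E}\,\|\hat X^{(n)}(\infty)\| \le C .$$
   Context: Notation: $u\wedge w=\min\{u,w\}$, $u\vee w=\max\{u,w\}$; $\|x\|=|x_1|+|x_2|$ for $x\in\mathbb{R}^2$. The $N$-system. There are two customer types, arriving as independent Poisson processes with rates $\Lambda_1>0$ and $\Lambda_2>0$, and two server pools with $B_1$ and $B_2$ identical servers, respectively. Service requirements of customers are independent exponential random variables with mean 1. Type 2 customers can be served only in pool 2, at rate $\mu_{22}>0$ each. Type 1 customers can be served in pool 1 at rate $\mu_{11}>0$ each, or in pool 2 at rate $\mu_{12}>0$ each. Let $X_i$ be the number of type $i$ customers in the system. Type 2 has absolute preemptive priority in pool 2: $X_2\wedge B_2$ type 2 customers are in service and the rest wait. Type 1 has absolute preference for pool 1 and lower (preempt-resume) priority in pool 2: $X_1\wedge B_1$ type 1 customers are served in pool 1, $[(X_1-B_1)\vee 0]\wedge[(B_2-X_2)\vee 0]$ are served in pool 2, and the rest wait. Hence $X(t)=(X_1(t),X_2(t))$ is a continuous-time Markov chain on $\mathbb{Z}_+^2$ with transitions: $X_i\to X_i+1$ at rate $\Lambda_i$ ($i=1,2$); $X_2\to X_2-1$ at rate $\mu_{22}(X_2\wedge B_2)$; $X_1\to X_1-1$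 at rate $\mu_{11}(X_1\wedge B_1)+\mu_{12}\{[(X_1-B_1)\vee 0]\wedge[(B_2-X_2)\vee 0]\}$. Halfin--Whitt regime. Fix positive parameters $b,\lambda_1,\lambda_2,\psi_{11},\psi_{12},\psi_{22},\mu_{11},\mu_{12},\mu_{22}$ with $\lambda_2=\psi_{22}\mu_{22}$ and $\lambda_1=\psi_{11}\mu_{11}+\psi_{12}\mu_{12}$. Consider a sequence of $N$-systems indexed by a positive scaling parameter $n$ increasing to infinity, where in the $n$-th system $\Lambda_1=\lambda_1 n$, $\Lambda_2=\lambda_2 n$, $B_1=\psi_{11}n$, $B_2=\psi_{12}n+\psi_{22}n+b\sqrt n$. Standing assumption: $B_1,B_2$ are integers for all $n$ considered. Let $X^{(n)}(\cdot)$ be the corresponding Markov chain; for all sufficiently large $n$ it is irreducible and positive recurrent, hence has a unique stationary distribution. The diffusion-scaled process $\hat X^{(n)}=(\hat X^{(n)}_1,\hat X^{(n)}_2)$ is $$\hat X_1^{(n)}=(X_1^{(n)}-\psi_{11}n-\psi_{12}n)/\sqrt n,\qquad \hat X_2^{(n)}=(X_2^{(n)}-\psi_{22}n)/\sqrt n .$$ *)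

theory Defs
  imports "HOL-Probability.Probability"
begin

text \<open>
  Continuous-time Markov chains, given by their transition probabilities: \<open>P t x\<close> is the law of the
  state at time \<open>t\<close> when the chain starts in \<open>x\<close>. Only times \<open>t \<ge> 0\<close> matter.
\<close>

definition generator :: "('s \<Rightarrow> 's \<Rightarrow> real) \<Rightarrow> 's \<Rightarrow> 's \<Rightarrow> real" where
  "generator q x y = (if y = x then - (\<Sum>\<^sub>\<infinity>z\<in>UNIV - {x}. q x z) else q x y)"

text \<open>
  \<open>q x y\<close> (for \<open>y \<noteq> x\<close>) is the rate of the transition from \<open>x\<close> to \<open>y\<close>. The derivative at \<open>0\<close> is
  one-sided. The semigroup with given rates is unique when the exit rates are bounded, as they are
  for the chain below.
\<close>

definition ctmc_with_rates ::
  "('s \<Rightarrow> 's \<Rightarrow> real) \<Rightarrow> (real \<Rightarrow> 's \<Rightarrow> 's pmf) \<Rightarrow> bool" where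
  "ctmc_with_rates q P \<longleftrightarrow>
     (\<forall>x. (\<lambda>y. q x y) summable_on (UNIV - {x})) \<and>
     (\<forall>x. P 0 x = return_pmf x) \<and>
     (\<forall>s\<ge>0. \<forall>t\<ge>0. \<forall>x. P (s + t) x = bind_pmf (P s x) (P t)) \<and>
     (\<forall>x y. ((\<lambda>t. pmf (P t x) y) has_real_derivative generator q x y) (at 0 within {0..}))"

definition stationary_distribution :: "(real \<Rightarrow> 's \<Rightarrow> 's pmf) \<Rightarrow> 's pmf \<Rightarrow> bool" where
  "stationary_distribution P \<pi> \<longleftrightarrow> (\<forall>t\<ge>0. bind_pmf \<pi> (P t) = \<pi>)"

text \<open>
  Transition rates of the N-system with absolute preemptive priorities. The state \<open>(x1, x2)\<close>
  counts the customers of each type, waiting or in service.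
\<close>

definition N_system_rates ::
  "real \<Rightarrow> real \<Rightarrow> nat \<Rightarrow> nat \<Rightarrow> real \<Rightarrow> real \<Rightarrow> real \<Rightarrow> nat \<times> nat \<Rightarrow> nat \<times> nat \<Rightarrow> real" where
  "N_system_rates \<Lambda>1 \<Lambda>2 B1 B2 \<mu>11 \<mu>12 \<mu>22 = (\<lambda>(x1, x2) (y1, y2).
     if y1 = x1 + 1 \<and> y2 = x2 then \<Lambda>1
     else if y1 = x1 \<and> y2 = x2 + 1 then \<Lambda>2
     else if y1 = x1 \<and> x2 = y2 + 1 then \<mu>22 * min (real x2) (real B2)
     else if x1 = y1 + 1 \<and> y2 = x2 then
       \<mu>11 * min (real x1) (real B1) +
       \<mu>12 * min (max (real x1 - real B1) 0) (max (real B2 - real x2) 0)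
     else 0)"

definition diffusion_scaling ::
  "real \<Rightarrow> real \<Rightarrow> real \<Rightarrow> real \<Rightarrow> nat \<times> nat \<Rightarrow> real \<times> real" where
  "diffusion_scaling \<psi>11 \<psi>12 \<psi>22 n = (\<lambda>(x1, x2).
     ((real x1 - \<psi>11 * n - \<psi>12 * n) / sqrt n, (real x2 - \<psi>22 * n) / sqrt n))"

text \<open>The library norm on \<open>real \<times> real\<close> is Euclidean.\<close>

definition l1_norm :: "real \<times> real \<Rightarrow> real" where
  "l1_norm x = \<bar>fst x\<bar> + \<bar>snd x\<bar>"

end

theory Submission
  imports Defs
begin

text \<open>
  Write \<open>u\<close> and \<open>v\<close> for the scaled numbers of type 1 and type 2 customers. When pool 2 has no spare
  capacity, \<open>v\<close> has drift \<open>- \<mu>22 * v'\<close> and \<open>u\<close> has drift \<open>- \<mu>12 * (b - v')\<close>, where \<open>v'\<close> is \<open>v\<close> truncated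
  at the scaled capacity of pool 2. The drift of \<open>u\<close> alone may thus be positive, but the combination
  \<open>u + \<kappa> * v\<close> with \<open>\<kappa> = \<mu>12 / \<mu>22\<close> has the constant drift \<open>- \<mu>12 * b\<close>: in the long run the
  safety staffing \<open>b\<close> prevails. In the other states \<open>u\<close> is driven back towards \<open>0\<close> at a rate at least
  proportional to \<open>\<bar>u\<bar>\<close>. Hence the generator maps the quadratic function
  \<open>(u + \<kappa> * v)\<^sup>2 + K * v\<^sup>2\<close>, for \<open>K\<close> large, to at most \<open>C - c * (\<bar>u\<bar> + \<bar>v\<bar>)\<close> with \<open>c > 0\<close> and
  \<open>C\<close> independent of \<open>n \<ge> 1\<close> (\<open>drift_estimate\<close>, \<open>N_system_lyapunov_drift\<close>). The term \<open>K * v\<^sup>2\<close>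
  makes up for the products of \<open>u\<close> and \<open>v\<close> in the drift of the first square; the second-order
  terms are bounded because the jump rates are of order \<open>n\<close> and the scaled jumps of order \<open>1 / sqrt n\<close>.

  A stationary distribution gives the image of a function under the generator mean zero, so
  formally \<open>c\<close> times the stationary mean of \<open>\<bar>u\<bar> + \<bar>v\<bar>\<close> is at most \<open>C\<close>. For the unbounded quadratic
  function this is justified by truncation (\<open>foster_lyapunov_moment_bound\<close>), starting from the global
  balance equations, which follow from stationarity of the semigroup because the exit rates of
  each system are bounded (\<open>stationary_balance\<close>).
\<close>

section \<open>Stationary moments of continuous-time Markov chains\<close>

lemma pmf_bind_ge:
  "pmf M y * pmf (f y) z \<le> pmf (bind_pmf M f) z"
proof -
  have "pmf M y * pmf (f y) z = measure_pmf.expectation M (\<lambda>x. indicator {y} x * pmf (f x) z)"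
    by (subst integral_measure_pmf_real[where A = "{y}"]) (auto simp: indicator_def)
  also have "\<dots> \<le> measure_pmf.expectation M (\<lambda>x. pmf (f x) z)"
    by (intro integral_mono measure_pmf.integrable_const_bound[where B = 1])
       (auto simp: indicator_def pmf_le_1)
  finally show ?thesis by (simp add: pmf_bind)
qed

lemma inverse_Suc_at_0_within:
  assumes "t > 0"
  shows "filterlim (\<lambda>k. t / real (Suc k)) (at 0 within {0..}) sequentially"
proof -
  have "(\<lambda>k. t / real (Suc k)) \<longlonglongrightarrow> 0"
    by (rule LIMSEQ_Suc, rule lim_const_over_n)
  then show ?thesis
    using assms by (auto simp: filterlim_at intro!: always_eventually)
qed

lemma ctmc_difference_quotient:
  assumes "ctmc_with_rates q P" "t > 0"
  shows "(\<lambda>k. (pmf (P (t / real (Suc k)) x) y - of_bool (x = y)) / (t / real (Suc k)))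
           \<longlonglongrightarrow> generator q x y"
proof -
  have "((\<lambda>t. pmf (P t x) y) has_real_derivative generator q x y) (at 0 within {0..})"
    and "pmf (P 0 x) y = of_bool (x = y)"
    using assms by (auto simp: ctmc_with_rates_def pmf_return)
  then have "((\<lambda>t. (pmf (P t x) y - of_bool (x = y)) / t) \<longlongrightarrow> generator q x y) (at 0 within {0..})"
    by (simp add: has_field_derivative_iff)
  from filterlim_compose[OF this inverse_Suc_at_0_within[OF assms(2)]] show ?thesis .
qed

text \<open>
  The probability of being elsewhere at time \<open>t\<close> is at most \<open>t\<close> times the exit rate. It is subadditive
  in \<open>t\<close>, hence at most \<open>k\<close> times its value at \<open>t / k\<close>, and this bound tends to \<open>t\<close> times its derivative
  at \<open>0\<close>, the exit rate.
\<close>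

lemma ctmc_leaving_probability:
  assumes P: "ctmc_with_rates q P" and t: "t \<ge> 0"
  shows "1 - pmf (P t x) x \<le> t * - generator q x x"
proof (cases "t = 0")
  case True
  then show ?thesis using P by (simp add: ctmc_with_rates_def)
next
  case False
  with t have t: "t > 0" by simp
  define \<phi> where "\<phi> s = 1 - pmf (P s x) x" for s
  have sub: "\<phi> (r + s) \<le> \<phi> r + \<phi> s" if "r \<ge> 0" "s \<ge> 0" for r s
  proof -
    have "pmf (P r x) x * pmf (P s x) x \<le> pmf (P (r + s) x) x"
      using P that pmf_bind_ge[of "P r x" x "P s" x] by (auto simp: ctmc_with_rates_def)
    moreover have "0 \<le> (1 - pmf (P r x) x) * (1 - pmf (P s x) x)"
      by (simp add: pmf_le_1)
    ultimately show ?thesis by (simp add: \<phi>_def algebra_simps)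
  qed
  have mult: "\<phi> (real (Suc k) * s) \<le> real (Suc k) * \<phi> s" if "s \<ge> 0" for k s
  proof (induction k)
    case (Suc k)
    have "\<phi> (real (Suc (Suc k)) * s) = \<phi> (real (Suc k) * s + s)"
      by (simp add: algebra_simps)
    also have "\<dots> \<le> \<phi> (real (Suc k) * s) + \<phi> s"
      using that by (intro sub) auto
    finally show ?case using Suc by (simp add: algebra_simps)
  qed simp
  have "\<phi> t \<le> t * - ((pmf (P (t / real (Suc k)) x) x - 1) / (t / real (Suc k)))" for k
  proof -
    define s where "s = t / real (Suc k)"
    have s: "s > 0" "t = real (Suc k) * s" using t by (auto simp: s_def)
    with mult[of s k] have "\<phi> t \<le> real (Suc k) * \<phi> s" by simp
    also have "\<dots> = t * - ((pmf (P s x) x - 1) / s)"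
      using s(1) unfolding s(2) by (simp add: \<phi>_def field_simps)
    finally show ?thesis by (simp only: s_def)
  qed
  moreover have "(\<lambda>k. t * - ((pmf (P (t / real (Suc k)) x) x - 1) / (t / real (Suc k))))
      \<longlonglongrightarrow> t * - generator q x x"
    using ctmc_difference_quotient[OF P t, of x x]
    by (intro tendsto_mult tendsto_minus tendsto_const) simp
  ultimately show ?thesis
    unfolding \<phi>_def by (intro LIMSEQ_le_const) auto
qed

text \<open>
  Global balance when the exit rates are bounded by \<open>Q\<close>. The difference quotients of
  \<open>t \<mapsto> pmf (P t x) y\<close> have \<open>\<pi>\<close>-mean \<open>0\<close>, converge to \<open>generator q x y\<close> and are bounded by \<open>Q\<close>
  uniformly in \<open>x\<close>, so dominated convergence applies.
\<close>

lemma stationary_balance: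
  assumes P: "ctmc_with_rates q P" and \<pi>: "stationary_distribution P \<pi>"
    and Q: "\<And>x. - generator q x x \<le> Q"
  shows "integrable (measure_pmf \<pi>) (\<lambda>x. generator q x y)"
    and "measure_pmf.expectation \<pi> (\<lambda>x. generator q x y) = 0"
proof -
  define f where
    "f k x = (pmf (P (1 / real (Suc k)) x) y - of_bool (x = y)) / (1 / real (Suc k))" for k x
  have lim: "(\<lambda>k. f k x) \<longlonglongrightarrow> generator q x y" for x
    unfolding f_def by (rule ctmc_difference_quotient[OF P]) simp
  have bound: "\<bar>f k x\<bar> \<le> Q" for k x
  proof -
    define t where "t = 1 / real (Suc k)"
    have t: "t > 0" by (simp add: t_def)
    have leave: "1 - pmf (P t x) x \<le> t * Q"
      using ctmc_leaving_probability[OF P, of t x] Q[of x] t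
      by (smt (verit) mult_left_mono)
    have "\<bar>pmf (P t x) y - of_bool (x = y)\<bar> \<le> 1 - pmf (P t x) x"
    proof (cases "x = y")
      case False
      have "pmf (P t x) x + pmf (P t x) y = measure (P t x) {x, y}"
        using False by (simp add: measure_measure_pmf_finite)
      also have "\<dots> \<le> 1" by simp
      finally show ?thesis using False by simp
    qed (simp add: pmf_le_1)
    with leave have "\<bar>pmf (P t x) y - of_bool (x = y)\<bar> \<le> t * Q" by simp
    moreover have "f k x = (pmf (P t x) y - of_bool (x = y)) / t"
      by (simp add: f_def t_def)
    ultimately show ?thesis
      using t by (simp add: abs_divide pos_divide_le_eq mult.commute)
  qed
  have zero: "measure_pmf.expectation \<pi> (f k) = 0" for k
  proof -
    define t where "t = 1 / real (Suc k)"
    have "bind_pmf \<pi> (P t) = \<pi>"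
      using \<pi> by (simp add: stationary_distribution_def t_def)
    then have "measure_pmf.expectation \<pi> (\<lambda>x. pmf (P t x) y) = pmf \<pi> y"
      by (metis pmf_bind)
    moreover have "measure_pmf.expectation \<pi> (\<lambda>x. of_bool (x = y)) = pmf \<pi> y"
      by (subst integral_measure_pmf_real[where A = "{y}"]) (auto split: if_splits)
    moreover have "integrable (measure_pmf \<pi>) (\<lambda>x. pmf (P t x) y)"
      "integrable (measure_pmf \<pi>) (\<lambda>x. of_bool (x = y) :: real)"
      by (rule measure_pmf.integrable_const_bound[where B = 1]; simp add: pmf_le_1)+
    moreover have "f k = (\<lambda>x. (pmf (P t x) y - of_bool (x = y)) / t)"
      by (simp add: f_def t_def fun_eq_iff)
    ultimately show ?thesis by simp
  qed
  show "integrable (measure_pmf \<pi>) (\<lambda>x. generator q x y)"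
    by (rule integrable_dominated_convergence[where w = "\<lambda>_. Q" and s = f])
       (use lim bound in auto)
  have "(\<lambda>k. measure_pmf.expectation \<pi> (f k))
      \<longlonglongrightarrow> measure_pmf.expectation \<pi> (\<lambda>x. generator q x y)"
    by (rule integral_dominated_convergence[where w = "\<lambda>_. Q"]) (use lim bound in auto)
  with zero show "measure_pmf.expectation \<pi> (\<lambda>x. generator q x y) = 0"
    by (simp add: LIMSEQ_const_iff)
qed

lemma generator_diagonal_finite:
  assumes "finite N" "\<And>y. y \<notin> N \<Longrightarrow> q x y = 0"
  shows "generator q x x = - (\<Sum>y\<in>N - {x}. q x y)"
proof -
  have "(\<Sum>\<^sub>\<infinity>z\<in>UNIV - {x}. q x z) = (\<Sum>\<^sub>\<infinity>z\<in>N - {x}. q x z)"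
    using assms(2) by (intro infsum_cong_neutral) auto
  with assms(1) show ?thesis by (simp add: generator_def)
qed

text \<open>
  The set \<open>N\<close> may contain \<open>x\<close> itself: its term on the right vanishes whatever \<open>q x x\<close> is.
\<close>

lemma generator_sum:
  fixes q :: "'s \<Rightarrow> 's \<Rightarrow> real"
  assumes N: "finite N" "\<And>y. y \<notin> N \<Longrightarrow> q x y = 0"
    and S: "finite S" "\<And>y. y \<notin> S \<Longrightarrow> h y = 0"
  shows "(\<Sum>y\<in>S. generator q x y * h y) = (\<Sum>y\<in>N. q x y * (h y - h x))"
proof -
  define T where "T = insert x (S \<union> N)"
  have T: "finite T" "S \<subseteq> T" "N - {x} \<subseteq> T - {x}" "x \<in> T" using N(1) S(1) by (auto simp: T_def)
  have "(\<Sum>y\<in>S. generator q x y * h y) = (\<Sum>y\<in>T. generator q x y * h y)"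
    using T S by (intro sum.mono_neutral_left) auto
  also have "\<dots> = generator q x x * h x + (\<Sum>y\<in>T - {x}. generator q x y * h y)"
    using T by (simp add: sum.remove)
  also have "(\<Sum>y\<in>T - {x}. generator q x y * h y) = (\<Sum>y\<in>T - {x}. q x y * h y)"
    by (rule sum.cong) (auto simp: generator_def)
  also have "\<dots> = (\<Sum>y\<in>N - {x}. q x y * h y)"
    using T N by (intro sum.mono_neutral_right) auto
  also have "generator q x x * h x + \<dots> = (\<Sum>y\<in>N - {x}. q x y * (h y - h x))"
    by (simp add: generator_diagonal_finite[where q = q and x = x, OF N] sum_subtractf right_diff_distrib sum_distrib_right)
  also have "\<dots> = (\<Sum>y\<in>N. q x y * (h y - h x))"
    using N(1) by (intro sum.mono_neutral_left) auto
  finally show ?thesis .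
qed

text \<open>
  The Foster--Lyapunov moment bound: a drift of \<open>V\<close> of at most \<open>C - g\<close> gives \<open>g\<close> a stationary mean of
  at most \<open>C\<close>. No moment of \<open>V\<close> is assumed. Instead of \<open>V\<close>, the generator is applied to the
  finitely supported function \<open>max 0 (m - V)\<close>, for which stationarity reduces to finitely many balance
  equations. Where \<open>V \<le> m\<close>, the result is at least \<open>g - C\<close>, and elsewhere it is nonnegative.
  This bounds the mean of \<open>g\<close> on \<open>{V \<le> m}\<close>, and \<open>m\<close> tends to infinity.
\<close>

lemma foster_lyapunov_moment_bound:
  fixes q :: "'s \<Rightarrow> 's \<Rightarrow> real" and V g :: "'s \<Rightarrow> real"
  assumes P: "ctmc_with_rates q P" and \<pi>: "stationary_distribution P \<pi>"
    and nonneg: "\<And>x y. q x y \<ge> 0"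
    and N: "\<And>x. finite (N x)" "\<And>x y. y \<notin> N x \<Longrightarrow> q x y = 0"
    and Q: "\<And>x. (\<Sum>y\<in>N x. q x y) \<le> Q"
    and sublevel: "\<And>m. finite {x. V x \<le> m}"
    and g: "\<And>x. g x \<ge> 0" and C: "C \<ge> 0"
    and drift: "\<And>x. (\<Sum>y\<in>N x. q x y * (V y - V x)) \<le> C - g x"
  shows "integrable (measure_pmf \<pi>) g" and "measure_pmf.expectation \<pi> g \<le> C"
proof -
  have Q': "- generator q x x \<le> Q" for x
  proof -
    have "(\<Sum>y\<in>N x - {x}. q x y) \<le> (\<Sum>y\<in>N x. q x y)"
      using N(1) nonneg by (intro sum_mono2) auto
    with Q[of x] show ?thesis by (simp add: generator_diagonal_finite[OF N(1) N(2)])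
  qed
  note balance = stationary_balance[OF P \<pi> Q']
  define gm where "gm m x = g x * indicator {x. V x \<le> m} x" for m x
  have gm: "integrable (measure_pmf \<pi>) (gm m) \<and> measure_pmf.expectation \<pi> (gm m) \<le> C" for m
  proof
    define S where "S = {x. V x \<le> m}"
    define h where "h y = max 0 (m - V y)" for y
    have S: "finite S" "\<And>y. y \<notin> S \<Longrightarrow> h y = 0"
      using sublevel by (auto simp: S_def h_def)
    have pointwise: "gm m x - C * indicator S x \<le> (\<Sum>y\<in>S. generator q x y * h y)" for x
    proof -
      have eq: "(\<Sum>y\<in>S. generator q x y * h y) = (\<Sum>y\<in>N x. q x y * (h y - h x))"
        by (rule generator_sum[OF N(1) N(2) S])
      show ?thesis
      proof (cases "V x \<le> m")
        case True
        \<comment> \<open>Truncation can only raise the increments of \<open>m - V\<close> out of \<open>x\<close>: \<open>h \<ge> m - V\<close>, with equality at \<open>x\<close>.\<close>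
        have "(\<Sum>y\<in>N x. q x y * (h y - h x)) \<ge> (\<Sum>y\<in>N x. - (q x y * (V y - V x)))"
        proof (rule sum_mono)
          fix y
          have "- (V y - V x) \<le> h y - h x" using True by (auto simp: h_def)
          from mult_left_mono[OF this nonneg[of x y]]
          show "- (q x y * (V y - V x)) \<le> q x y * (h y - h x)" by (simp add: algebra_simps)
        qed
        with drift[of x] True eq show ?thesis by (simp add: gm_def S_def sum_negf)
      next
        case False
        then have "h x = 0" by (simp add: h_def)
        then have "0 \<le> (\<Sum>y\<in>N x. q x y * (h y - h x))"
          using nonneg by (intro sum_nonneg) (auto simp: h_def)
        with False eq show ?thesis by (simp add: gm_def S_def)
      qed
    qed
    show int: "integrable (measure_pmf \<pi>) (gm m)"
    proof (rule measure_pmf.integrable_const_bound[where B = "sum g S"])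
      have "\<bar>gm m x\<bar> \<le> sum g S" for x
        using g member_le_sum[of x S g] S(1) sum_nonneg[of S g] by (auto simp: gm_def S_def indicator_def)
      then show "AE x in measure_pmf \<pi>. norm (gm m x) \<le> sum g S" by simp
    qed simp
    have indint: "integrable (measure_pmf \<pi>) (\<lambda>x. indicator S x :: real)"
      by (rule measure_pmf.integrable_const_bound[where B = 1]) (auto simp: indicator_def)
    have "measure_pmf.expectation \<pi> (gm m) - C * measure \<pi> S
        = measure_pmf.expectation \<pi> (\<lambda>x. gm m x - C * indicator S x)"
      using int indint by (subst Bochner_Integration.integral_diff) auto
    also have "\<dots> \<le> measure_pmf.expectation \<pi> (\<lambda>x. \<Sum>y\<in>S. generator q x y * h y)"
      using int indint balance(1) pointwise by (intro integral_mono) auto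
    also have "\<dots> = 0" using balance by simp
    finally have "measure_pmf.expectation \<pi> (gm m) \<le> C * measure \<pi> S" by simp
    also have "\<dots> \<le> C" using C by (simp add: mult_left_le)
    finally show "measure_pmf.expectation \<pi> (gm m) \<le> C" .
  qed
  have gm_nonneg: "gm m x \<ge> 0" for m x using g by (simp add: gm_def)
  have nn: "(\<integral>\<^sup>+x. ennreal (g x) \<partial>\<pi>) \<le> ennreal C"
  proof -
    have "ennreal (g x) = (SUP m. ennreal (gm (real m) x))" for x
    proof (rule antisym)
      obtain m where "V x \<le> real m" using real_arch_simple by blast
      then have "g x = gm (real m) x" by (simp add: gm_def)
      then show "ennreal (g x) \<le> (SUP m. ennreal (gm (real m) x))"
        by (metis SUP_upper UNIV_I)
      show "(SUP m. ennreal (gm (real m) x)) \<le> ennreal (g x)"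
        using g by (intro SUP_least ennreal_leI) (auto simp: gm_def indicator_def)
    qed
    then have "(\<integral>\<^sup>+x. ennreal (g x) \<partial>\<pi>) = (\<integral>\<^sup>+x. (SUP m. ennreal (gm (real m) x)) \<partial>\<pi>)"
      by simp
    also have "\<dots> = (SUP m. \<integral>\<^sup>+x. ennreal (gm (real m) x) \<partial>\<pi>)"
      using g by (intro nn_integral_monotone_convergence_SUP)
        (auto simp: incseq_def le_fun_def gm_def indicator_def intro!: ennreal_leI)
    also have "\<dots> \<le> ennreal C"
    proof (rule SUP_least)
      fix m :: nat
      have "(\<integral>\<^sup>+x. ennreal (gm (real m) x) \<partial>\<pi>) = ennreal (measure_pmf.expectation \<pi> (gm (real m)))"
        using gm[of "real m"] g by (intro nn_integral_eq_integral) (simp_all add: gm_nonneg)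
      also have "\<dots> \<le> ennreal C" using gm by (intro ennreal_leI) auto
      finally show "(\<integral>\<^sup>+x. ennreal (gm (real m) x) \<partial>\<pi>) \<le> ennreal C" .
    qed
    finally show ?thesis .
  qed
  show int: "integrable (measure_pmf \<pi>) g"
    using nn g by (intro integrableI_nonneg) (auto simp: less_top[symmetric] top_unique neq_top_trans)
  have "ennreal (measure_pmf.expectation \<pi> g) \<le> ennreal C"
    using nn nn_integral_eq_integral[OF int] g by simp
  then show "measure_pmf.expectation \<pi> g \<le> C" using C by simp
qed

section \<open>A drift inequality on the diffusion scale\<close>

lemma truncated_square_lower_bound:
  fixes b M v :: real
  assumes "M \<ge> 0" "b > 0"
  shows "b * \<bar>v\<bar> \<le> v * min v (M + b) + b\<^sup>2"
proof (cases "v \<le> M + b")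
  case True
  have "0 \<le> (\<bar>v\<bar> - b)\<^sup>2 + b * \<bar>v\<bar>" using assms by (intro add_nonneg_nonneg) auto
  with True show ?thesis by (simp add: power2_eq_square algebra_simps)
next
  case False
  moreover from this have "v * b \<le> v * (M + b)" using assms by (intro mult_left_mono) auto
  ultimately show ?thesis using assms by (simp add: mult.commute add_increasing2)
qed

text \<open>
  Here \<open>u\<close> and \<open>v\<close> are the two scaled coordinates, \<open>M\<close> is \<open>\<psi>12 * sqrt n\<close>, \<open>D\<close> is the scaled drift of
  type 1, and for \<open>\<kappa> = \<mu>12 / \<mu>22\<close> the scaled drift of \<open>\<kappa> * v\<close> is \<open>- \<mu>12 * v'\<close>; truncating \<open>v\<close> at \<open>M + b\<close> accounts for
  the capacity of pool 2. The constants depend neither on \<open>M\<close> nor on the state. When the spare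
  capacity of pool 2 is exhausted (\<open>u \<ge> b - v'\<close>), the drift of \<open>u + \<kappa> * v\<close> is exactly
  \<open>- \<mu>12 * b\<close>; otherwise \<open>u\<close> itself has a linear restoring drift, and the mixed products of \<open>u\<close> and \<open>v\<close>
  are absorbed by \<open>u\<^sup>2\<close> and \<open>v * v'\<close>. The lower bound on \<open>u\<close> says that there are no fewer than zero type 1
  customers; it is needed where \<open>v > M + b\<close>, as \<open>v * v'\<close> then grows only linearly in \<open>v\<close>.
\<close>

lemma drift_estimate:
  fixes b \<mu>11 \<mu>12 \<psi> \<kappa> :: real
  assumes pos: "b > 0" "\<mu>11 > 0" "\<mu>12 > 0" "\<psi> > 0" "\<kappa> > 0"
  obtains c K C where "c > 0" "K > 0" "C \<ge> 0"
    "\<And>u v M D v'. \<lbrakk>M \<ge> 0; u \<ge> - (1 + \<psi>) * M; v' = min v (M + b);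
       D = (if u \<ge> - M then - \<mu>12 * min u (b - v') else \<mu>11 * (- M - u) + \<mu>12 * M)\<rbrakk>
       \<Longrightarrow> 2 * (u + \<kappa> * v) * (D - \<mu>12 * v') \<le> C - c * \<bar>u\<bar> + K * (v * v')"
proof -
  define m where "m = min \<mu>11 \<mu>12"
  define G where "G = 2 * (\<kappa> * (\<mu>11 + \<mu>12) + \<mu>12)"
  define c where "c = min (2 * \<mu>12 * b) m"
  define KA where "KA = (4 * \<mu>12 * b + 2 * \<mu>12 * b * \<kappa>) / b"
  define KB where "KB = \<mu>12 * (1 + \<kappa>)\<^sup>2"
  define KC where "KC = G\<^sup>2 / (4 * m) + G * (1 + \<psi>)"
  define K where "K = KA + KB + KC"
  define C where "C = KA * b\<^sup>2 + \<mu>12 + m"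
  have mpos: "m > 0" "m \<le> \<mu>11" "m \<le> \<mu>12" using pos by (auto simp: m_def)
  have Gpos: "G > 0" using pos by (auto simp: G_def intro!: add_pos_pos mult_pos_pos)
  have cpos: "c > 0" "c \<le> 2 * \<mu>12 * b" "c \<le> m" using pos mpos by (auto simp: c_def)
  have KA: "KA > 0" "KA * b = 4 * \<mu>12 * b + 2 * \<mu>12 * b * \<kappa>"
    using pos by (auto simp: KA_def intro!: divide_pos_pos add_pos_pos mult_pos_pos)
  have KB: "KB > 0" using pos by (auto simp: KB_def)
  have KC: "KC > 0" using mpos Gpos pos by (auto simp: KC_def intro!: add_nonneg_pos)
  show thesis
  proof (rule that[of c K C])
    show "c > 0" "K > 0" "C \<ge> 0"
      using cpos KA KB KC pos mpos by (auto simp: K_def C_def)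
    fix u v M D v' :: real
    assume M: "M \<ge> 0" and u: "u \<ge> - (1 + \<psi>) * M" and v': "v' = min v (M + b)"
      and D: "D = (if u \<ge> - M then - \<mu>12 * min u (b - v') else \<mu>11 * (- M - u) + \<mu>12 * M)"
    define E where "E = v * v'"
    have v'_cases: "v = v' \<or> (v > v' \<and> v' = M + b)" using v' by auto
    have E_sq: "v'\<^sup>2 \<le> E"
      using v'_cases M pos by (auto simp: E_def power2_eq_square)
    then have E0: "E \<ge> 0" by (smt (verit) zero_le_power2)
    have E_lin: "b * \<bar>v\<bar> \<le> E + b\<^sup>2"
      using truncated_square_lower_bound[of M b v] M pos by (simp add: E_def v')
    have parts: "KA * E \<le> K * E" "KB * E \<le> K * E" "KC * E \<le> K * E"
      using E0 KA(1) KB KC by (auto simp: K_def intro!: mult_right_mono)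
    have KAb: "KA * b\<^sup>2 \<ge> 0" using KA pos by auto
    consider (A) "u \<ge> - M" "u \<ge> b - v'" | (B) "u \<ge> - M" "u < b - v'" | (C) "u < - M" by linarith
    then have "2 * (u + \<kappa> * v) * (D - \<mu>12 * v') \<le> C - c * \<bar>u\<bar> + K * E"
    proof cases
      case A
      \<comment> \<open>The two occurrences of \<open>v'\<close> cancel.\<close>
      then have DA: "D - \<mu>12 * v' = - \<mu>12 * b" by (simp add: D algebra_simps)
      have "\<bar>u\<bar> - 2 * \<bar>v\<bar> \<le> u" using A v' pos by (auto simp: abs_if)
      moreover have "- (\<kappa> * \<bar>v\<bar>) \<le> \<kappa> * v"
        using pos mult_left_mono[of "- \<bar>v\<bar>" v \<kappa>] by auto
      ultimately have "\<bar>u\<bar> - (2 + \<kappa>) * \<bar>v\<bar> \<le> u + \<kappa> * v" by (simp add: algebra_simps)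
      then have "2 * \<mu>12 * b * (\<bar>u\<bar> - (2 + \<kappa>) * \<bar>v\<bar>) \<le> 2 * \<mu>12 * b * (u + \<kappa> * v)"
        using pos by (intro mult_left_mono) auto
      moreover have "KA * (b * \<bar>v\<bar>) = (4 * \<mu>12 * b + 2 * \<mu>12 * b * \<kappa>) * \<bar>v\<bar>"
        using KA(2) by (simp only: mult.assoc[symmetric])
      ultimately have "2 * (u + \<kappa> * v) * (D - \<mu>12 * v') \<le> - 2 * \<mu>12 * b * \<bar>u\<bar> + KA * (b * \<bar>v\<bar>)"
        unfolding DA by (simp add: algebra_simps)
      also have "\<dots> \<le> - c * \<bar>u\<bar> + KA * (E + b\<^sup>2)"
        using KA(1) mult_right_mono[OF cpos(2), of "\<bar>u\<bar>"] mult_left_mono[OF E_lin, of KA]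
        by linarith
      finally show ?thesis
        using parts pos mpos by (simp add: C_def algebra_simps)
    next
      case B
      \<comment> \<open>If \<open>v\<close> were truncated, then \<open>u < b - v' = - M\<close>.\<close>
      then have v: "v' = v" using v'_cases by auto
      have "2 * (u + \<kappa> * v) * (D - \<mu>12 * v') = \<mu>12 * (- 2 * (u\<^sup>2 + (1 + \<kappa>) * (u * v) + \<kappa> * v\<^sup>2))"
        using B by (simp add: D v power2_eq_square algebra_simps)
      also have "\<dots> \<le> \<mu>12 * (1 - \<bar>u\<bar> + (1 + \<kappa>)\<^sup>2 * v\<^sup>2)"
      proof (rule mult_left_mono)
        have "0 \<le> (u + (1 + \<kappa>) * v)\<^sup>2" "0 \<le> \<kappa> * v\<^sup>2" "0 \<le> (\<bar>u\<bar> - 1)\<^sup>2"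
          using pos by auto
        then show "- 2 * (u\<^sup>2 + (1 + \<kappa>) * (u * v) + \<kappa> * v\<^sup>2) \<le> 1 - \<bar>u\<bar> + (1 + \<kappa>)\<^sup>2 * v\<^sup>2"
          by (simp add: power2_eq_square algebra_simps)
      qed (use pos in auto)
      also have "\<dots> = \<mu>12 - \<mu>12 * \<bar>u\<bar> + KB * E"
        by (simp add: KB_def E_def v power2_eq_square algebra_simps)
      finally show ?thesis
        using parts KAb mpos mult_right_mono[of c \<mu>12 "\<bar>u\<bar>"] cpos by (simp add: C_def)
    next
      case C
      then have u0: "u < 0" using M by simp
      have D': "D = \<mu>11 * (- M - u) + \<mu>12 * M" using C D by simp
      have D_low: "D \<ge> m * \<bar>u\<bar>"
      proof -
        have "m * (- M - u) \<le> \<mu>11 * (- M - u)" "m * M \<le> \<mu>12 * M"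
          using mpos C M by (auto intro!: mult_right_mono)
        then show ?thesis using D' u0 by (simp add: algebra_simps)
      qed
      have D_up: "D \<le> (\<mu>11 + \<mu>12) * \<bar>u\<bar>"
      proof -
        have "\<mu>11 * (- M - u) \<le> \<mu>11 * \<bar>u\<bar>" "\<mu>12 * M \<le> \<mu>12 * \<bar>u\<bar>"
          using pos C M u0 by (intro mult_left_mono; simp)+
        then show ?thesis using D' by (simp add: algebra_simps)
      qed
      have D0: "D \<ge> 0" using D_low mpos by (smt (verit) mult_nonneg_nonneg)
      have vv: "\<bar>v'\<bar> \<le> \<bar>v\<bar>" using v' M pos by auto
      have t1: "u * D \<le> - (m * u\<^sup>2)"
        using mult_left_mono_neg[OF D_low, of u] u0 by (simp add: power2_eq_square algebra_simps)
      have t2: "\<kappa> * (v * D) \<le> \<kappa> * ((\<mu>11 + \<mu>12) * (\<bar>u\<bar> * \<bar>v\<bar>))"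
      proof (rule mult_left_mono)
        have "v * D \<le> \<bar>v\<bar> * D" using D0 by (intro mult_right_mono) auto
        also have "\<dots> \<le> \<bar>v\<bar> * ((\<mu>11 + \<mu>12) * \<bar>u\<bar>)" using D_up by (intro mult_left_mono) auto
        finally show "v * D \<le> (\<mu>11 + \<mu>12) * (\<bar>u\<bar> * \<bar>v\<bar>)" by (simp add: algebra_simps)
      qed (use pos in auto)
      have t3: "\<mu>12 * - (u * v') \<le> \<mu>12 * (\<bar>u\<bar> * \<bar>v\<bar>)"
      proof (rule mult_left_mono)
        have "- (u * v') \<le> \<bar>u\<bar> * \<bar>v'\<bar>" by (metis abs_ge_minus_self abs_mult)
        also have "\<dots> \<le> \<bar>u\<bar> * \<bar>v\<bar>" using vv by (intro mult_left_mono) auto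
        finally show "- (u * v') \<le> \<bar>u\<bar> * \<bar>v\<bar>" .
      qed (use pos in auto)
      have t4: "0 \<le> \<kappa> * \<mu>12 * E" using pos E0 by auto
      have "2 * (u + \<kappa> * v) * (D - \<mu>12 * v')
          = 2 * (u * D + \<kappa> * (v * D) + \<mu>12 * - (u * v') - \<kappa> * \<mu>12 * E)"
        by (simp add: E_def algebra_simps)
      also have "\<dots> \<le> 2 * (- (m * u\<^sup>2) + \<kappa> * ((\<mu>11 + \<mu>12) * (\<bar>u\<bar> * \<bar>v\<bar>)) + \<mu>12 * (\<bar>u\<bar> * \<bar>v\<bar>))"
        using add_mono[OF add_mono[OF t1 t2] t3] t4 by simp
      also have "\<dots> = - 2 * m * u\<^sup>2 + G * (\<bar>u\<bar> * \<bar>v\<bar>)"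
        by (simp add: G_def algebra_simps)
      also have "G * (\<bar>u\<bar> * \<bar>v\<bar>) \<le> m * u\<^sup>2 + KC * E"
        using v'_cases
      proof
        assume v: "v = v'"
        \<comment> \<open>Completing the square.\<close>
        have "0 \<le> m * (\<bar>u\<bar> - G / (2 * m) * \<bar>v\<bar>)\<^sup>2" using mpos by auto
        also have "\<dots> = m * u\<^sup>2 - G * (\<bar>u\<bar> * \<bar>v\<bar>) + G\<^sup>2 / (4 * m) * v\<^sup>2"
          using mpos by (simp add: power2_eq_square field_simps)
        finally have "G * (\<bar>u\<bar> * \<bar>v\<bar>) \<le> m * u\<^sup>2 + G\<^sup>2 / (4 * m) * E"
          using v by (simp add: E_def power2_eq_square)
        moreover have "G\<^sup>2 / (4 * m) * E \<le> KC * E"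
          using Gpos pos E0 by (intro mult_right_mono) (auto simp: KC_def)
        ultimately show ?thesis by linarith
      next
        assume v: "v > v' \<and> v' = M + b"
        then have v0: "v > 0" using M pos by auto
        have "\<bar>u\<bar> * \<bar>v\<bar> \<le> ((1 + \<psi>) * v') * v"
        proof -
          have "\<bar>u\<bar> \<le> (1 + \<psi>) * M" using u u0 by (simp add: algebra_simps)
          also have "\<dots> \<le> (1 + \<psi>) * v'" using v pos by (intro mult_left_mono) auto
          finally show ?thesis using v0 by (auto intro!: mult_right_mono)
        qed
        then have "G * (\<bar>u\<bar> * \<bar>v\<bar>) \<le> G * (((1 + \<psi>) * v') * v)"
          using Gpos by (intro mult_left_mono) auto
        also have "\<dots> = (G * (1 + \<psi>)) * E" by (simp add: E_def algebra_simps)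
        also have "\<dots> \<le> KC * E"
          using mpos E0 by (intro mult_right_mono) (auto simp: KC_def)
        finally show ?thesis using mpos by (smt (verit) mult_nonneg_nonneg zero_le_power2)
      qed
      finally have "2 * (u + \<kappa> * v) * (D - \<mu>12 * v') \<le> - (m * u\<^sup>2) + KC * E" by simp
      moreover have "m * \<bar>u\<bar> \<le> m + m * u\<^sup>2"
      proof -
        have "0 \<le> (\<bar>u\<bar> - 1)\<^sup>2 + \<bar>u\<bar>" by (intro add_nonneg_nonneg) auto
        then have "\<bar>u\<bar> \<le> 1 + u\<^sup>2" by (simp add: power2_eq_square algebra_simps)
        from mult_left_mono[OF this, of m] show ?thesis using mpos by (simp add: algebra_simps)
      qed
      moreover have "c * \<bar>u\<bar> \<le> m * \<bar>u\<bar>" using cpos by (intro mult_right_mono) auto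
      ultimately show ?thesis
        using parts KAb pos by (simp add: C_def)
    qed
    then show "2 * (u + \<kappa> * v) * (D - \<mu>12 * v') \<le> C - c * \<bar>u\<bar> + K * (v * v')"
      by (simp add: E_def)
  qed
qed

section \<open>The generator of the N-system\<close>

text \<open>
  A superset of the states reachable in one jump. The subtractions are truncated, so on the
  axes the set contains the state itself, to which the rate is \<open>0\<close>.
\<close>

definition N_neighbours :: "nat \<times> nat \<Rightarrow> (nat \<times> nat) set" where
  "N_neighbours = (\<lambda>(x1, x2). {(x1 + 1, x2), (x1, x2 + 1), (x1 - 1, x2), (x1, x2 - 1)})"

lemma finite_N_neighbours: "finite (N_neighbours x)"
  by (simp add: N_neighbours_def split_beta)

lemma N_system_rates_outside_neighbours:
  "y \<notin> N_neighbours x \<Longrightarrow> N_system_rates \<Lambda>1 \<Lambda>2 B1 B2 \<mu>11 \<mu>12 \<mu>22 x y = 0"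
  by (auto simp: N_neighbours_def N_system_rates_def split: prod.splits)

lemma N_system_rates_nonneg:
  assumes "\<Lambda>1 \<ge> 0" "\<Lambda>2 \<ge> 0" "\<mu>11 \<ge> 0" "\<mu>12 \<ge> 0" "\<mu>22 \<ge> 0"
  shows "N_system_rates \<Lambda>1 \<Lambda>2 B1 B2 \<mu>11 \<mu>12 \<mu>22 x y \<ge> 0"
  using assms by (auto simp: N_system_rates_def split: prod.splits)

lemma N_system_rates_sum:
  fixes f :: "nat \<times> nat \<Rightarrow> real"
  shows "(\<Sum>y\<in>N_neighbours (x1, x2). N_system_rates \<Lambda>1 \<Lambda>2 B1 B2 \<mu>11 \<mu>12 \<mu>22 (x1, x2) y * f y) =
    \<Lambda>1 * f (x1 + 1, x2) + \<Lambda>2 * f (x1, x2 + 1) +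
    (\<mu>11 * min (real x1) (real B1) +
     \<mu>12 * min (max (real x1 - real B1) 0) (max (real B2 - real x2) 0)) * f (x1 - 1, x2) +
    \<mu>22 * min (real x2) (real B2) * f (x1, x2 - 1)"
  by (cases x1; cases x2) (simp_all add: N_neighbours_def N_system_rates_def)

lemma N_system_exit_rate_le:
  assumes "\<mu>11 \<ge> 0" "\<mu>12 \<ge> 0" "\<mu>22 \<ge> 0"
  shows "(\<Sum>y\<in>N_neighbours x. N_system_rates \<Lambda>1 \<Lambda>2 B1 B2 \<mu>11 \<mu>12 \<mu>22 x y) \<le>
    \<Lambda>1 + \<Lambda>2 + \<mu>11 * real B1 + \<mu>12 * real B2 + \<mu>22 * real B2"
proof -
  obtain x1 x2 where x: "x = (x1, x2)" by fastforce
  have "\<mu>11 * min (real x1) (real B1) \<le> \<mu>11 * real B1"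
    "\<mu>12 * min (max (real x1 - real B1) 0) (max (real B2 - real x2) 0) \<le> \<mu>12 * real B2"
    "\<mu>22 * min (real x2) (real B2) \<le> \<mu>22 * real B2"
    using assms by (auto intro!: mult_left_mono)
  then show ?thesis
    using N_system_rates_sum[of \<Lambda>1 \<Lambda>2 B1 B2 \<mu>11 \<mu>12 \<mu>22 x1 x2 "\<lambda>_. 1"] by (simp add: x)
qed

text \<open>
  The generator applied to a quadratic function has no remainder term: it is the gradient times the
  drift plus a combination of the jump rates with constant coefficients.
\<close>

lemma N_system_quadratic_drift:
  fixes s p r \<kappa> K \<mu>11 \<mu>12 \<mu>22 :: real and x1 x2 B1 B2 :: nat
  defines "u x \<equiv> (real (fst x) - p) / s" and "v x \<equiv> (real (snd x) - r) / s"
  defines "V x \<equiv> (u x + \<kappa> * v x)\<^sup>2 + K * (v x)\<^sup>2"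
  defines "d1 \<equiv> \<mu>11 * min (real x1) (real B1) +
      \<mu>12 * min (max (real x1 - real B1) 0) (max (real B2 - real x2) 0)"
    and "d2 \<equiv> \<mu>22 * min (real x2) (real B2)"
  assumes s: "s > 0"
  shows "(\<Sum>y\<in>N_neighbours (x1, x2).
        N_system_rates \<Lambda>1 \<Lambda>2 B1 B2 \<mu>11 \<mu>12 \<mu>22 (x1, x2) y * (V y - V (x1, x2))) =
      2 * (u (x1, x2) + \<kappa> * v (x1, x2)) * ((\<Lambda>1 - d1) / s + \<kappa> * ((\<Lambda>2 - d2) / s))
      + 2 * K * v (x1, x2) * ((\<Lambda>2 - d2) / s)
      + ((\<Lambda>1 + d1) / s\<^sup>2 + (\<kappa>\<^sup>2 + K) * ((\<Lambda>2 + d2) / s\<^sup>2))"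
proof -
  define h where "h = 1 / s"
  define U where "U = u (x1, x2)"
  define W where "W = v (x1, x2)"
  have V: "V (x1, x2) = (U + \<kappa> * W)\<^sup>2 + K * W\<^sup>2" by (simp add: V_def U_def W_def)
  have up: "V (x1 + 1, x2) = (U + h + \<kappa> * W)\<^sup>2 + K * W\<^sup>2"
    "V (x1, x2 + 1) = (U + \<kappa> * (W + h))\<^sup>2 + K * (W + h)\<^sup>2"
    by (simp_all add: V_def U_def W_def u_def v_def h_def diff_divide_distrib add_divide_distrib
        algebra_simps)
  \<comment> \<open>At \<open>x1 = 0\<close> the truncated \<open>x1 - 1\<close> is harmless, since \<open>d1 = 0\<close>.\<close>
  have down1: "d1 * (V (x1 - 1, x2) - V (x1, x2))
      = d1 * ((U - h + \<kappa> * W)\<^sup>2 + K * W\<^sup>2 - ((U + \<kappa> * W)\<^sup>2 + K * W\<^sup>2))"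
  proof (cases "x1 = 0")
    case False
    then have "u (x1 - 1, x2) = U - h" "v (x1 - 1, x2) = W"
      by (simp_all add: U_def W_def u_def v_def h_def of_nat_diff diff_divide_distrib)
    then show ?thesis unfolding V by (simp add: V_def)
  qed (simp add: d1_def)
  have down2: "d2 * (V (x1, x2 - 1) - V (x1, x2))
      = d2 * ((U + \<kappa> * (W - h))\<^sup>2 + K * (W - h)\<^sup>2 - ((U + \<kappa> * W)\<^sup>2 + K * W\<^sup>2))"
  proof (cases "x2 = 0")
    case False
    then have "u (x1, x2 - 1) = U" "v (x1, x2 - 1) = W - h"
      by (simp_all add: U_def W_def u_def v_def h_def of_nat_diff diff_divide_distrib)
    then show ?thesis unfolding V by (simp add: V_def)
  qed (simp add: d2_def)
  have "(\<Sum>y\<in>N_neighbours (x1, x2).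
        N_system_rates \<Lambda>1 \<Lambda>2 B1 B2 \<mu>11 \<mu>12 \<mu>22 (x1, x2) y * (V y - V (x1, x2))) =
    \<Lambda>1 * (V (x1 + 1, x2) - V (x1, x2)) + \<Lambda>2 * (V (x1, x2 + 1) - V (x1, x2)) +
    d1 * (V (x1 - 1, x2) - V (x1, x2)) + d2 * (V (x1, x2 - 1) - V (x1, x2))"
    by (subst N_system_rates_sum) (simp add: d1_def d2_def)
  also have "\<dots> = 2 * (U + \<kappa> * W) * ((\<Lambda>1 - d1) * h + \<kappa> * ((\<Lambda>2 - d2) * h))
      + 2 * K * W * ((\<Lambda>2 - d2) * h)
      + ((\<Lambda>1 + d1) * h\<^sup>2 + (\<kappa>\<^sup>2 + K) * ((\<Lambda>2 + d2) * h\<^sup>2))"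
    unfolding down1 down2 up unfolding V by algebra
  finally show ?thesis
    by (simp add: h_def U_def W_def power_divide)
qed

text \<open>
  With \<open>s = sqrt n\<close>, the scaled drift of the number of type 2 customers.
\<close>

lemma N_system_type2_drift:
  fixes s b x2 B2 :: real
  assumes s: "s > 0" and B2: "B2 = \<psi>12 * s\<^sup>2 + \<psi>22 * s\<^sup>2 + b * s"
  shows "(\<psi>22 * \<mu>22 * s\<^sup>2 - \<mu>22 * min x2 B2) / s
    = - \<mu>22 * min ((x2 - \<psi>22 * s\<^sup>2) / s) (\<psi>12 * s + b)"
proof -
  define v where "v = (x2 - \<psi>22 * s\<^sup>2) / s"
  have x2: "x2 = \<psi>22 * s\<^sup>2 + s * v" using s by (simp add: v_def)
  have "B2 = \<psi>22 * s\<^sup>2 + s * (\<psi>12 * s + b)" by (simp add: B2 power2_eq_square algebra_simps)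
  then have "min x2 B2 = \<psi>22 * s\<^sup>2 + s * min v (\<psi>12 * s + b)"
    using s by (simp add: x2 min_mult_distrib_left flip: min_add_distrib_right)
  then have "(\<psi>22 * \<mu>22 * s\<^sup>2 - \<mu>22 * min x2 B2) / s = - \<mu>22 * min v (\<psi>12 * s + b)"
    using s by (simp add: field_simps)
  then show ?thesis by (simp add: v_def)
qed

text \<open>
  The scaled drift of the number of type 1 customers. The spare capacity of pool 2 is
  \<open>s * (M + b - v')\<close>. For \<open>u < - M\<close> there are fewer than \<open>B1\<close> type 1 customers, all of them in pool 1.
\<close>

lemma N_system_type1_drift:
  fixes s b x1 x2 B1 B2 \<psi>11 \<psi>12 \<psi>22 :: real
  assumes s: "s > 0" and B1: "B1 = \<psi>11 * s\<^sup>2"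
    and B2: "B2 = \<psi>12 * s\<^sup>2 + \<psi>22 * s\<^sup>2 + b * s"
  defines "M \<equiv> \<psi>12 * s"
  defines "u \<equiv> (x1 - \<psi>11 * s\<^sup>2 - \<psi>12 * s\<^sup>2) / s"
    and "v' \<equiv> min ((x2 - \<psi>22 * s\<^sup>2) / s) (M + b)"
  shows "((\<psi>11 * \<mu>11 + \<psi>12 * \<mu>12) * s\<^sup>2 -
      (\<mu>11 * min x1 B1 + \<mu>12 * min (max (x1 - B1) 0) (max (B2 - x2) 0))) / s =
    (if u \<ge> - M then - \<mu>12 * min u (b - v') else \<mu>11 * (- M - u) + \<mu>12 * M)"
proof -
  define y where "y = u + M"
  define z where "z = M + b - v'"
  have x1: "x1 = B1 + s * y"
    using s by (simp add: y_def u_def M_def B1 field_simps power2_eq_square)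
  have z: "z \<ge> 0" by (simp add: z_def v'_def)
  have "B2 - x2 = s * (M + b - (x2 - \<psi>22 * s\<^sup>2) / s)"
    using s by (simp add: B2 M_def field_simps power2_eq_square)
  then have B2x: "max (B2 - x2) 0 = s * z"
    using s by (auto simp: z_def v'_def min_def max_def zero_le_mult_iff not_le mult_le_0_iff)
  have sM: "\<psi>12 * s\<^sup>2 = s * M" by (simp add: M_def power2_eq_square)
  show ?thesis
  proof (cases "u \<ge> - M")
    case True
    then have y: "y \<ge> 0" by (simp add: y_def)
    then have "min x1 B1 = B1" "max (x1 - B1) 0 = s * y" using s by (simp_all add: x1)
    moreover have "min (s * y) (s * z) = s * (M + min u (b - v'))"
      using s by (auto simp: min_def y_def z_def)
    ultimately show ?thesis
      using True s sM by (simp add: B2x B1 field_simps)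
  next
    case False
    then have y: "y < 0" by (simp add: y_def)
    then have "s * y < 0" using s by (simp add: mult_pos_neg)
    then have "min x1 B1 = B1 + s * y" "max (x1 - B1) 0 = 0" by (simp_all add: x1)
    moreover have "min 0 (s * z) = 0" using s z by simp
    ultimately show ?thesis
      using False s sM by (simp add: B2x B1 y_def field_simps)
  qed
qed

section \<open>The Lyapunov function\<close>

text \<open>
  The Lyapunov function on the diffusion scale, used with \<open>\<kappa> = \<mu>12 / \<mu>22\<close> and \<open>K\<close> large.
\<close>

definition N_lyapunov :: "real \<Rightarrow> real \<Rightarrow> real \<times> real \<Rightarrow> real" where
  "N_lyapunov \<kappa> K = (\<lambda>(u, v). (u + \<kappa> * v)\<^sup>2 + K * v\<^sup>2)"

lemma N_lyapunov_sublevel_finite: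
  assumes n: "n > 0" and K: "K > 0"
  shows "finite {x. N_lyapunov \<kappa> K (diffusion_scaling \<psi>11 \<psi>12 \<psi>22 n x) \<le> m}"
proof -
  define c2 where "c2 = 1 + m / K"
  define c1 where "c1 = 1 + m + \<bar>\<kappa>\<bar> * c2"
  define A where "A = \<psi>11 * n + \<psi>12 * n + sqrt n * c1"
  define B where "B = \<psi>22 * n + sqrt n * c2"
  have le: "\<bar>z\<bar> \<le> 1 + z\<^sup>2" for z :: real
  proof -
    have "0 \<le> (\<bar>z\<bar> - 1)\<^sup>2 + \<bar>z\<bar>" by (intro add_nonneg_nonneg) auto
    then show ?thesis by (simp add: power2_eq_square algebra_simps)
  qed
  have "{x. N_lyapunov \<kappa> K (diffusion_scaling \<psi>11 \<psi>12 \<psi>22 n x) \<le> m}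
      \<subseteq> {..nat \<lceil>A\<rceil>} \<times> {..nat \<lceil>B\<rceil>}"
  proof
    fix x assume x: "x \<in> {x. N_lyapunov \<kappa> K (diffusion_scaling \<psi>11 \<psi>12 \<psi>22 n x) \<le> m}"
    obtain x1 x2 where x12: "x = (x1, x2)" by fastforce
    define u where "u = (real x1 - \<psi>11 * n - \<psi>12 * n) / sqrt n"
    define v where "v = (real x2 - \<psi>22 * n) / sqrt n"
    have V: "(u + \<kappa> * v)\<^sup>2 + K * v\<^sup>2 \<le> m"
      using x by (simp add: x12 N_lyapunov_def diffusion_scaling_def u_def v_def)
    have "K * v\<^sup>2 \<le> m" using V by (smt (verit) zero_le_power2)
    then have "v\<^sup>2 \<le> m / K" using K by (simp add: field_simps)
    then have v: "\<bar>v\<bar> \<le> c2" using le[of v] by (simp add: c2_def)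
    have "0 \<le> K * v\<^sup>2" using K by simp
    then have "\<bar>u + \<kappa> * v\<bar> \<le> 1 + m" using V le[of "u + \<kappa> * v"] by linarith
    moreover have "\<bar>\<kappa> * v\<bar> \<le> \<bar>\<kappa>\<bar> * c2" using v by (simp add: abs_mult mult_left_mono)
    ultimately have u: "u \<le> c1" by (simp add: c1_def)
    have "real x1 = \<psi>11 * n + \<psi>12 * n + sqrt n * u" "real x2 = \<psi>22 * n + sqrt n * v"
      using n by (simp_all add: u_def v_def)
    moreover have "sqrt n * u \<le> sqrt n * c1" "sqrt n * v \<le> sqrt n * c2"
      using u v n by (auto intro!: mult_left_mono)
    ultimately have "real x1 \<le> A" "real x2 \<le> B" by (simp_all add: A_def B_def)
    then show "x \<in> {..nat \<lceil>A\<rceil>} \<times> {..nat \<lceil>B\<rceil>}"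
      by (simp add: x12) linarith
  qed
  then show ?thesis by (rule finite_subset) auto
qed

lemma pool2_capacity_le_linear:
  fixes n :: real
  assumes "n \<ge> 1" "b \<ge> 0" "\<mu> \<ge> 0" "B2 = \<psi>12 * n + \<psi>22 * n + b * sqrt n"
  shows "\<mu> * B2 \<le> \<mu> * (\<psi>12 + \<psi>22 + b) * n"
proof -
  have "sqrt n \<le> n" using assms(1) by (simp add: real_le_lsqrt power2_eq_square)
  then have "B2 \<le> (\<psi>12 + \<psi>22 + b) * n"
    using assms(2,4) by (simp add: algebra_simps mult_left_mono)
  from mult_left_mono[OF this assms(3)] show ?thesis by (simp add: mult.assoc)
qed

lemma N_system_type1_total_rate_bound:
  fixes n :: real
  assumes n: "n \<ge> 1"
    and nonneg: "b \<ge> 0" "\<mu>11 \<ge> 0" "\<mu>12 \<ge> 0" "x2 \<ge> 0"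
    and B1: "B1 = \<psi>11 * n" "B1 \<ge> 0" and B2: "B2 = \<psi>12 * n + \<psi>22 * n + b * sqrt n" "B2 \<ge> 0"
  shows "(lambda1 * n + (\<mu>11 * min x1 B1 +
       \<mu>12 * min (max (x1 - B1) 0) (max (B2 - x2) 0))) / n
         \<le> lambda1 + \<mu>11 * \<psi>11 + \<mu>12 * (\<psi>12 + \<psi>22 + b)"
proof -
  have "\<mu>11 * min x1 B1 \<le> \<mu>11 * B1"
    "\<mu>12 * min (max (x1 - B1) 0) (max (B2 - x2) 0) \<le> \<mu>12 * B2"
    using nonneg B2 by (auto intro!: mult_left_mono)
  then have "lambda1 * n + (\<mu>11 * min x1 B1 + \<mu>12 * min (max (x1 - B1) 0) (max (B2 - x2) 0))
      \<le> (lambda1 + \<mu>11 * \<psi>11 + \<mu>12 * (\<psi>12 + \<psi>22 + b)) * n"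
    using pool2_capacity_le_linear[OF n nonneg(1,3) B2(1)] by (simp add: B1(1) algebra_simps)
  then show ?thesis using n by (simp add: pos_divide_le_eq)
qed

lemma N_system_type2_total_rate_bound:
  fixes n :: real
  assumes n: "n \<ge> 1" and nonneg: "b \<ge> 0" "\<mu>22 \<ge> 0"
    and B2: "B2 = \<psi>12 * n + \<psi>22 * n + b * sqrt n"
  shows "(lambda2 * n + \<mu>22 * min x2 B2) / n \<le> lambda2 + \<mu>22 * (\<psi>12 + \<psi>22 + b)"
proof -
  have "\<mu>22 * min x2 B2 \<le> \<mu>22 * B2" using nonneg by (intro mult_left_mono) auto
  then have "lambda2 * n + \<mu>22 * min x2 B2 \<le> (lambda2 + \<mu>22 * (\<psi>12 + \<psi>22 + b)) * n"
    using pool2_capacity_le_linear[OF n nonneg B2] by (simp add: algebra_simps)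
  then show ?thesis using n by (simp add: pos_divide_le_eq)
qed

text \<open>
  The drift inequality on which the theorem rests. The constants \<open>c\<close>, \<open>K\<close> and \<open>C\<close> do not depend on \<open>n\<close>.
\<close>

lemma N_system_lyapunov_drift:
  fixes b lambda1 lambda2 \<psi>11 \<psi>12 \<psi>22 \<mu>11 \<mu>12 \<mu>22 :: real
  assumes pos: "b > 0" "lambda1 > 0" "lambda2 > 0" "\<psi>11 > 0" "\<psi>12 > 0" "\<psi>22 > 0"
      "\<mu>11 > 0" "\<mu>12 > 0" "\<mu>22 > 0"
    and lambda2: "lambda2 = \<psi>22 * \<mu>22"
    and lambda1: "lambda1 = \<psi>11 * \<mu>11 + \<psi>12 * \<mu>12"
  obtains c K C where "c > 0" "K > 0" "C \<ge> 0"
    "\<And>n B1 B2 x. \<lbrakk>n \<ge> 1; real B1 = \<psi>11 * n; real B2 = \<psi>12 * n + \<psi>22 * n + b * sqrt n\<rbrakk> \<Longrightarrow>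
      (\<Sum>y\<in>N_neighbours x.
        N_system_rates (lambda1 * n) (lambda2 * n) B1 B2 \<mu>11 \<mu>12 \<mu>22 x y *
        (N_lyapunov (\<mu>12 / \<mu>22) K (diffusion_scaling \<psi>11 \<psi>12 \<psi>22 n y) -
         N_lyapunov (\<mu>12 / \<mu>22) K (diffusion_scaling \<psi>11 \<psi>12 \<psi>22 n x)))
      \<le> C - c * l1_norm (diffusion_scaling \<psi>11 \<psi>12 \<psi>22 n x)"
proof -
  define \<kappa> where "\<kappa> = \<mu>12 / \<mu>22"
  have \<kappa>: "\<kappa> > 0" "\<kappa> * \<mu>22 = \<mu>12" using pos by (simp_all add: \<kappa>_def)
  \<comment> \<open>The number of type 1 customers is nonnegative: \<open>u \<ge> - (\<psi>11 + \<psi>12) * sqrt n = - (1 + \<psi>11 / \<psi>12) * M\<close>.\<close>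
  have "\<psi>11 / \<psi>12 > 0" using pos by simp
  from drift_estimate[OF pos(1) pos(7) pos(8) this \<kappa>(1)] obtain c0 K0 C0
    where c0: "c0 > 0" and K0: "K0 > 0" and C0: "C0 \<ge> 0"
      and est: "\<And>u v M D v'. \<lbrakk>M \<ge> 0; u \<ge> - (1 + \<psi>11 / \<psi>12) * M; v' = min v (M + b);
       D = (if u \<ge> - M then - \<mu>12 * min u (b - v') else \<mu>11 * (- M - u) + \<mu>12 * M)\<rbrakk>
       \<Longrightarrow> 2 * (u + \<kappa> * v) * (D - \<mu>12 * v') \<le> C0 - c0 * \<bar>u\<bar> + K0 * (v * v')"
    by metis
  \<comment> \<open>The drift of \<open>K * v\<^sup>2\<close> then offsets \<open>K0 * (v * v')\<close> and leaves \<open>- (v * v')\<close> to control \<open>\<bar>v\<bar>\<close>.\<close>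
  define K where "K = (K0 + 1) / (2 * \<mu>22)"
  have K: "K > 0" "2 * K * \<mu>22 = K0 + 1" using K0 pos by (simp_all add: K_def)
  define R1 where "R1 = lambda1 + \<mu>11 * \<psi>11 + \<mu>12 * (\<psi>12 + \<psi>22 + b)"
  define R2 where "R2 = lambda2 + \<mu>22 * (\<psi>12 + \<psi>22 + b)"
  define R where "R = R1 + (\<kappa>\<^sup>2 + K) * R2"
  have R: "R \<ge> 0" using pos K by (auto simp: R_def R1_def R2_def)
  define c where "c = min c0 b"
  have c: "c > 0" "c \<le> c0" "c \<le> b" using c0 pos by (auto simp: c_def)
  show thesis
  proof (rule that[of c K "C0 + b\<^sup>2 + R"])
    fix n :: real and B1 B2 :: nat and x :: "nat \<times> nat"
    assume n: "n \<ge> 1" and B1: "real B1 = \<psi>11 * n"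
      and B2: "real B2 = \<psi>12 * n + \<psi>22 * n + b * sqrt n"
    define s where "s = sqrt n"
    have s: "s > 0" "s\<^sup>2 = n" using n by (simp_all add: s_def)
    obtain x1 x2 where x: "x = (x1, x2)" by fastforce
    define u where "u = (real x1 - \<psi>11 * n - \<psi>12 * n) / s"
    define v where "v = (real x2 - \<psi>22 * n) / s"
    define M where "M = \<psi>12 * s"
    define v' where "v' = min v (M + b)"
    define D where
      "D = (if u \<ge> - M then - \<mu>12 * min u (b - v') else \<mu>11 * (- M - u) + \<mu>12 * M)"
    define d1 where "d1 = \<mu>11 * min (real x1) (real B1) +
      \<mu>12 * min (max (real x1 - real B1) 0) (max (real B2 - real x2) 0)"
    define d2 where "d2 = \<mu>22 * min (real x2) (real B2)"
    have M: "M \<ge> 0" using pos s by (simp add: M_def)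
    have D1: "(lambda1 * n - d1) / s = D"
      using N_system_type1_drift[of s "real B1" \<psi>11 "real B2" \<psi>12 \<psi>22 b \<mu>11 \<mu>12 "real x1" "real x2"]
        s B1 B2
      by (simp only: lambda1 d1_def D_def u_def v'_def v_def M_def s_def[symmetric])
    have D2: "(lambda2 * n - d2) / s = - \<mu>22 * v'"
      using N_system_type2_drift[of s "real B2" \<psi>12 \<psi>22 b \<mu>22 "real x2"] s B2
      by (simp only: lambda2 d2_def v'_def v_def M_def s_def[symmetric])
    have R': "(lambda1 * n + d1) / s\<^sup>2 + (\<kappa>\<^sup>2 + K) * ((lambda2 * n + d2) / s\<^sup>2) \<le> R"
    proof -
      have "(lambda1 * n + d1) / n \<le> R1"
        unfolding R1_def d1_def
        by (rule N_system_type1_total_rate_bound) (use n pos B1 B2 in auto)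
      moreover have "(lambda2 * n + d2) / n \<le> R2"
        unfolding R2_def d2_def
        by (rule N_system_type2_total_rate_bound) (use n pos B2 in auto)
      ultimately show ?thesis
        unfolding s(2) R_def using K by (intro add_mono mult_left_mono) auto
    qed
    have u_low: "u \<ge> - (1 + \<psi>11 / \<psi>12) * M"
    proof -
      have "- (1 + \<psi>11 / \<psi>12) * M = - (\<psi>11 * n + \<psi>12 * n) / s"
        using pos s(1) by (simp add: M_def field_simps power2_eq_square flip: s(2))
      also have "\<dots> \<le> u"
        using s(1) by (auto simp: u_def intro!: divide_right_mono)
      finally show ?thesis .
    qed
    have scaled: "diffusion_scaling \<psi>11 \<psi>12 \<psi>22 n y =
        ((real (fst y) - (\<psi>11 * n + \<psi>12 * n)) / s, (real (snd y) - \<psi>22 * n) / s)" for y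
      by (simp add: diffusion_scaling_def s_def split_beta diff_diff_eq)
    have scaled_x: "diffusion_scaling \<psi>11 \<psi>12 \<psi>22 n x = (u, v)"
      by (simp add: scaled x u_def v_def diff_diff_eq)
    have "(\<Sum>y\<in>N_neighbours x.
        N_system_rates (lambda1 * n) (lambda2 * n) B1 B2 \<mu>11 \<mu>12 \<mu>22 x y *
        (N_lyapunov \<kappa> K (diffusion_scaling \<psi>11 \<psi>12 \<psi>22 n y) -
         N_lyapunov \<kappa> K (diffusion_scaling \<psi>11 \<psi>12 \<psi>22 n x)))
      = 2 * (u + \<kappa> * v) * ((lambda1 * n - d1) / s + \<kappa> * ((lambda2 * n - d2) / s))
        + 2 * K * v * ((lambda2 * n - d2) / s)
        + ((lambda1 * n + d1) / s\<^sup>2 + (\<kappa>\<^sup>2 + K) * ((lambda2 * n + d2) / s\<^sup>2))"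
      using N_system_quadratic_drift[OF s(1), where ?x1.0 = x1 and ?x2.0 = x2 and ?B1.0 = B1
          and ?B2.0 = B2 and ?\<mu>11.0 = \<mu>11 and ?\<mu>12.0 = \<mu>12 and ?\<mu>22.0 = \<mu>22
          and ?\<Lambda>1.0 = "lambda1 * n" and ?\<Lambda>2.0 = "lambda2 * n"
          and p = "\<psi>11 * n + \<psi>12 * n" and r = "\<psi>22 * n" and \<kappa> = \<kappa> and K = K]
      by (simp add: N_lyapunov_def scaled x u_def v_def d1_def d2_def diff_diff_eq)
    also have "\<dots> = 2 * (u + \<kappa> * v) * (D - \<mu>12 * v') - (K0 + 1) * (v * v')
        + ((lambda1 * n + d1) / s\<^sup>2 + (\<kappa>\<^sup>2 + K) * ((lambda2 * n + d2) / s\<^sup>2))"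
      unfolding D1 D2 K(2)[symmetric] \<kappa>(2)[symmetric] by (simp add: algebra_simps)
    also have "\<dots> \<le> C0 - c0 * \<bar>u\<bar> - v * v' + R"
      using est[OF M u_low v'_def D_def] R' by (simp add: algebra_simps)
    also have "\<dots> \<le> C0 - c0 * \<bar>u\<bar> - b * \<bar>v\<bar> + b\<^sup>2 + R"
      using truncated_square_lower_bound[OF M pos(1), of v] by (simp add: v'_def)
    also have "\<dots> \<le> C0 + b\<^sup>2 + R - c * (\<bar>u\<bar> + \<bar>v\<bar>)"
      using mult_right_mono[OF c(2), of "\<bar>u\<bar>"] mult_right_mono[OF c(3), of "\<bar>v\<bar>"]
      by (simp add: algebra_simps)
    also have "\<bar>u\<bar> + \<bar>v\<bar> = l1_norm (diffusion_scaling \<psi>11 \<psi>12 \<psi>22 n x)"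
      by (simp add: scaled_x l1_norm_def)
    finally show "(\<Sum>y\<in>N_neighbours x.
        N_system_rates (lambda1 * n) (lambda2 * n) B1 B2 \<mu>11 \<mu>12 \<mu>22 x y *
        (N_lyapunov (\<mu>12 / \<mu>22) K (diffusion_scaling \<psi>11 \<psi>12 \<psi>22 n y) -
         N_lyapunov (\<mu>12 / \<mu>22) K (diffusion_scaling \<psi>11 \<psi>12 \<psi>22 n x)))
      \<le> C0 + b\<^sup>2 + R - c * l1_norm (diffusion_scaling \<psi>11 \<psi>12 \<psi>22 n x)"
      by (simp only: \<kappa>_def)
  qed (use c K C0 R in auto)
qed

section \<open>Tightness of the stationary distributions\<close>

theorem theorem2:
  fixes b lambda1 lambda2 \<psi>11 \<psi>12 \<psi>22 \<mu>11 \<mu>12 \<mu>22 :: real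
    and n :: "nat \<Rightarrow> real"
    and B1 B2 :: "nat \<Rightarrow> nat"
    and P :: "nat \<Rightarrow> real \<Rightarrow> nat \<times> nat \<Rightarrow> (nat \<times> nat) pmf"
  assumes "b > 0" "lambda1 > 0" "lambda2 > 0" "\<psi>11 > 0" "\<psi>12 > 0" "\<psi>22 > 0"
    and "\<mu>11 > 0" "\<mu>12 > 0" "\<mu>22 > 0"
    and "lambda2 = \<psi>22 * \<mu>22"
    and "lambda1 = \<psi>11 * \<mu>11 + \<psi>12 * \<mu>12"
    and "\<And>k. n k > 0" "mono n" "filterlim n at_top sequentially"
    and "\<And>k. real (B1 k) = \<psi>11 * n k"
    and "\<And>k. real (B2 k) = \<psi>12 * n k + \<psi>22 * n k + b * sqrt (n k)"
    and "\<And>k. ctmc_with_rates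
           (N_system_rates (lambda1 * n k) (lambda2 * n k) (B1 k) (B2 k) \<mu>11 \<mu>12 \<mu>22) (P k)"
  shows "\<exists>C>0. \<forall>\<^sub>F k in sequentially. \<forall>\<pi>. stationary_distribution (P k) \<pi> \<longrightarrow>
           (let \<pi>hat = map_pmf (diffusion_scaling \<psi>11 \<psi>12 \<psi>22 (n k)) \<pi>
            in integrable (measure_pmf \<pi>hat) l1_norm \<and>
               measure_pmf.expectation \<pi>hat l1_norm \<le> C)"
proof -
  obtain c K C where c: "c > 0" and K: "K > 0" and C: "C \<ge> 0"
    and drift: "\<And>n B1 B2 x.
      \<lbrakk>n \<ge> 1; real B1 = \<psi>11 * n; real B2 = \<psi>12 * n + \<psi>22 * n + b * sqrt n\<rbrakk> \<Longrightarrow>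
      (\<Sum>y\<in>N_neighbours x.
        N_system_rates (lambda1 * n) (lambda2 * n) B1 B2 \<mu>11 \<mu>12 \<mu>22 x y *
        (N_lyapunov (\<mu>12 / \<mu>22) K (diffusion_scaling \<psi>11 \<psi>12 \<psi>22 n y) -
         N_lyapunov (\<mu>12 / \<mu>22) K (diffusion_scaling \<psi>11 \<psi>12 \<psi>22 n x)))
      \<le> C - c * l1_norm (diffusion_scaling \<psi>11 \<psi>12 \<psi>22 n x)"
    by (fact N_system_lyapunov_drift[OF assms(1-11)])
  \<comment> \<open>The added \<open>1\<close> only keeps the constant positive when \<open>C = 0\<close>.\<close>
  have bound: "integrable (measure_pmf (map_pmf (diffusion_scaling \<psi>11 \<psi>12 \<psi>22 (n k)) \<pi>)) l1_norm \<and>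
      measure_pmf.expectation (map_pmf (diffusion_scaling \<psi>11 \<psi>12 \<psi>22 (n k)) \<pi>) l1_norm \<le> C / c + 1"
    if k: "n k \<ge> 1" and \<pi>: "stationary_distribution (P k) \<pi>" for k \<pi>
  proof -
    define g where "g x = c * l1_norm (diffusion_scaling \<psi>11 \<psi>12 \<psi>22 (n k) x)" for x
    have rates: "N_system_rates (lambda1 * n k) (lambda2 * n k) (B1 k) (B2 k) \<mu>11 \<mu>12 \<mu>22 x y \<ge> 0" for x y
      using assms(2,3,7-9) k by (intro N_system_rates_nonneg) auto
    have exit: "(\<Sum>y\<in>N_neighbours x.
        N_system_rates (lambda1 * n k) (lambda2 * n k) (B1 k) (B2 k) \<mu>11 \<mu>12 \<mu>22 x y) \<le>
        lambda1 * n k + lambda2 * n k + \<mu>11 * real (B1 k) + \<mu>12 * real (B2 k) + \<mu>22 * real (B2 k)" for x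
      using assms(7-9) by (intro N_system_exit_rate_le) auto
    have g: "g x \<ge> 0" for x using c by (simp add: g_def l1_norm_def)
    have drift_k: "(\<Sum>y\<in>N_neighbours x.
        N_system_rates (lambda1 * n k) (lambda2 * n k) (B1 k) (B2 k) \<mu>11 \<mu>12 \<mu>22 x y *
        (N_lyapunov (\<mu>12 / \<mu>22) K (diffusion_scaling \<psi>11 \<psi>12 \<psi>22 (n k) y) -
         N_lyapunov (\<mu>12 / \<mu>22) K (diffusion_scaling \<psi>11 \<psi>12 \<psi>22 (n k) x))) \<le> C - g x" for x
      unfolding g_def by (rule drift[OF k assms(15,16)])
    note moment = foster_lyapunov_moment_bound[where N = N_neighbours and g = g
        and V = "\<lambda>x. N_lyapunov (\<mu>12 / \<mu>22) K (diffusion_scaling \<psi>11 \<psi>12 \<psi>22 (n k) x)",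
        OF assms(17) \<pi> rates finite_N_neighbours N_system_rates_outside_neighbours exit
        N_lyapunov_sublevel_finite[OF assms(12) K] g C drift_k]
    have "integrable (measure_pmf \<pi>) (\<lambda>x. l1_norm (diffusion_scaling \<psi>11 \<psi>12 \<psi>22 (n k) x))"
      using moment(1) c by (simp add: g_def[abs_def])
    moreover have "c * measure_pmf.expectation \<pi>
        (\<lambda>x. l1_norm (diffusion_scaling \<psi>11 \<psi>12 \<psi>22 (n k) x)) \<le> C"
      using moment(2) by (simp add: g_def[abs_def])
    then have "measure_pmf.expectation \<pi>
        (\<lambda>x. l1_norm (diffusion_scaling \<psi>11 \<psi>12 \<psi>22 (n k) x)) \<le> C / c"
      using c by (simp add: pos_le_divide_eq mult.commute)
    ultimately show ?thesis by simp
  qed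
  have "\<forall>\<^sub>F k in sequentially. n k \<ge> 1"
    using assms(14) by (simp add: filterlim_at_top)
  then have "\<forall>\<^sub>F k in sequentially. \<forall>\<pi>. stationary_distribution (P k) \<pi> \<longrightarrow>
           (let \<pi>hat = map_pmf (diffusion_scaling \<psi>11 \<psi>12 \<psi>22 (n k)) \<pi>
            in integrable (measure_pmf \<pi>hat) l1_norm \<and>
               measure_pmf.expectation \<pi>hat l1_norm \<le> C / c + 1)"
    by eventually_elim (use bound in \<open>auto simp: Let_def\<close>)
  moreover have "C / c + 1 > 0" using c C by (intro add_nonneg_pos) auto
  ultimately show ?thesis by blast
qed

end
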